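(* Let $\mathcal{I}=(N,M,\mathcal{V})$ be a fair division instance with additive valuations, let $\epsilon\ge 0$, and let $\mathcal{I}'=(N',M',\mathcal{V}')=\mathtt{reduce}(\mathcal{I},\epsilon)$. Then for every agent $i\in N'$, $\mathrm{MMS}_i(\mathcal{I}')=\mathrm{MMS}^{|N'|}_{v'_i}(M')\ge 1-4\epsilon$.
   Context: An instance $(N,M,\mathcal{V})$ has agents $N=[n]$, a finite set $M$ of $m$ indivisible goods, and additive valuations $v_i:2^M\to\mathbb{R}_{\ge0}$. For a valuation $v$, a set $S$ and integer $d\ge1$, $\mathrm{MMS}^d_v(S)$ is the maximum over all partitions $(P_1,\dots,P_d)$ of $S$ into $d$ bundles of $\min_j v(P_j)$; $\mathrm{MMS}_i=\mathrm{MMS}^{n}_{v_i}(M)$. An instance is ordered if $M=[m]$ and $v_i(1)\ge v_i(2)\ge\dots\ge v_i(m)$ for every agent $i$. For $\mathcal{I}=([n],[m],\mathcal{V})$, $\mathtt{order}(\mathcal{I})=([n],[m],\mathcal{V}')$ where $v'_i(j)$ is the $j$-th largest number in the multiset $\{v_i(g):g\in[m]\}$. Reduction rules for an ordered instance with $n$ agents and threshold $\alpha$: $R^\alpha_1$ is applicable if some agent $i$ has $v_i(\{1\})\ge\alpha$; $R^\alpha_2$ if some $i$ has $v_i(\{2n-1,2n,2n+1\})\ge\alpha$; $R^\alpha_3$ if some $i$ has $v_i(\{3n-2,3n-1,3n,3n+1\})\ge\alpha$; $R^\alpha_4$ if some $i$ has $v_i(\{1,2n+1\})\ge\alpha$.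 Applying the rule gives the corresponding set to such an agent $i$ and removes $i$ and these goods; the remaining goods are re-indexed $1,2,\dots$ preserving their order (so the instance remains ordered). $\mathtt{reduce}(\mathcal{I},\epsilon)$: (1) replace $\mathcal{I}$ by $\mathtt{order}(\mathcal{I})$; (2) for every agent $i$ and good $g$ set $v_i(g)\leftarrow v_i(g)/\mathrm{MMS}_i$ (so every agent's MMS value becomes $1$); (3) while one of $R^{3/4+\epsilon}_1,R^{3/4+\epsilon}_2,R^{3/4+\epsilon}_3,R^{3/4+\epsilon}_4$ is applicable, apply $R^{3/4+\epsilon}_k$ for the smallest applicable $k$. The output is the instance formed by the remaining agents, remaining goods and the valuations from step (2). *)

theory Defs
  imports Complex_Main "HOL-Library.FuncSet" "HOL-Library.Multiset"
begin

text \<open>Additive valuations: a valuation is given by its values on single goods,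
 v(S) = sum v S. Partitions of S into d (possibly empty) bundles are encoded as
 assignments f : S -> {0..<d}; bundle j is {g in S. f g = j}.\<close>

definition mms :: "nat \<Rightarrow> ('a \<Rightarrow> real) \<Rightarrow> 'a set \<Rightarrow> real" where
  "mms d v S = Max {Min ((\<lambda>j. sum v {g \<in> S. f g = j}) ` {..<d}) | f. f \<in> S \<rightarrow>\<^sub>E {..<d}}"

definition ordv :: "'g set \<Rightarrow> (nat \<Rightarrow> 'g \<Rightarrow> real) \<Rightarrow> nat \<Rightarrow> nat \<Rightarrow> real" where
  "ordv M v i j = (if 1 \<le> j \<and> j \<le> card M
     then rev (sorted_list_of_multiset (image_mset (v i) (mset_set M))) ! (j - 1) else 0)"

definition normv :: "nat set \<Rightarrow> 'g set \<Rightarrow> (nat \<Rightarrow> 'g \<Rightarrow> real) \<Rightarrow> nat \<Rightarrow> nat \<Rightarrow> real" where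
  "normv N M v i j = ordv M v i j / mms (card N) (ordv M v i) {1..card M}"

text \<open>Positions (1-based, in the current re-indexed ordered instance with n agents)
 of the goods handed out by rule R_k.\<close>
definition rule_pos :: "nat \<Rightarrow> nat \<Rightarrow> nat set" where
  "rule_pos k n = (if k = 1 then {1}
     else if k = 2 then {2*n-1, 2*n, 2*n+1}
     else if k = 3 then {3*n-2, 3*n-1, 3*n, 3*n+1}
     else {1, 2*n+1})"

text \<open>A state is (remaining agents, remaining goods as a list of original ordered indices in
 increasing order); position p refers to G ! (p-1). Positions beyond the number of remaining
 goods refer to no good.\<close>
definition rule_goods :: "nat \<Rightarrow> nat set \<Rightarrow> nat list \<Rightarrow> nat set" where
  "rule_goods k A G = (\<lambda>p. G ! (p - 1)) ` (rule_pos k (card A) \<inter> {1..length G})"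

definition remove_pos :: "nat \<Rightarrow> nat set \<Rightarrow> nat list \<Rightarrow> nat list" where
  "remove_pos k A G = map (\<lambda>p. G ! (p - 1))
      (filter (\<lambda>p. p \<notin> rule_pos k (card A)) [1..<Suc (length G)])"

definition applicable :: "(nat \<Rightarrow> nat \<Rightarrow> real) \<Rightarrow> real \<Rightarrow> nat \<Rightarrow> nat set \<Rightarrow> nat list \<Rightarrow> bool" where
  "applicable w \<alpha> k A G = (\<exists>i\<in>A. sum (w i) (rule_goods k A G) \<ge> \<alpha>)"

inductive reduce_loop :: "(nat \<Rightarrow> nat \<Rightarrow> real) \<Rightarrow> real \<Rightarrow> nat set \<Rightarrow> nat list \<Rightarrow> nat set \<Rightarrow> nat list \<Rightarrow> bool"
  for w \<alpha> where
  stop: "\<not> (\<exists>k\<in>{1..4}. applicable w \<alpha> k A G) \<Longrightarrow> reduce_loop w \<alpha> A G A G"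
| step: "k \<in> {1..4} \<Longrightarrow> applicable w \<alpha> k A G \<Longrightarrow> (\<forall>k'\<in>{1..<k}. \<not> applicable w \<alpha> k' A G) \<Longrightarrow>
         i \<in> A \<Longrightarrow> sum (w i) (rule_goods k A G) \<ge> \<alpha> \<Longrightarrow>
         reduce_loop w \<alpha> (A - {i}) (remove_pos k A G) A' G' \<Longrightarrow> reduce_loop w \<alpha> A G A' G'"

text \<open>reduce(I, eps) outputs remaining agents N', remaining goods M' (original ordered indices)
 with valuations normv N M v.\<close>
definition reduce :: "nat set \<Rightarrow> 'g set \<Rightarrow> (nat \<Rightarrow> 'g \<Rightarrow> real) \<Rightarrow> real \<Rightarrow> nat set \<Rightarrow> nat set \<Rightarrow> bool" where
  "reduce N M v \<epsilon> N' M' = (\<exists>G'. reduce_loop (normv N M v) (3/4 + \<epsilon>) N [1..<Suc (card M)] N' G'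
      \<and> M' = set G')"

end

theory Submission
  imports Defs "HOL-Library.Disjoint_Sets"
begin

text \<open>
  Let \<open>\<alpha> = 3/4 + \<epsilon> \<le> 1\<close>, \<open>s = \<alpha>/3\<close> and \<open>\<tau> = 1 - \<alpha>\<close>, so that \<open>3s + \<tau> = 1\<close> and \<open>\<tau> \<le> s\<close>. Rules 1 to 3
  never decrease the maximin share of a remaining agent; rule 4 may, if the agent values the removed
  pair at more than the share, and such losses could accumulate. The remedy is to lower the agent's
  values once, at the beginning: a value in \<open>[(k - 1)s, ks)\<close> is capped at \<open>k\<tau>\<close>. The cap preserves the
  order of the goods, and every bundle of value at least \<open>1\<close> keeps value at least \<open>4\<tau> = 1 - 4\<epsilon>\<close>: if
  the levels \<open>k\<close> of the goods that exceed their caps sum up to at least \<open>4\<close>, these caps suffice, and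
  otherwise the capping costs at most \<open>3(s - \<tau>)\<close>. When rule 4 applies, rules 1 and 2 do not, so the
  removed pair has capped value at most \<open>3\<tau> + \<tau>\<close>. Hence no rule lowers the capped share below \<open>4\<tau>\<close>.
\<close>

section \<open>Maximin shares\<close>

text \<open>For \<^term>\<open>d = 0\<close> the definition of \<^const>\<open>mms\<close> takes the minimum of an empty set, whence the
  assumption \<^term>\<open>0 < d\<close> throughout.\<close>

lemma le_mms_iff:
  assumes "finite S" "0 < d"
  shows "t \<le> mms d v S \<longleftrightarrow> (\<exists>f\<in>S \<rightarrow> {..<d}. \<forall>j<d. t \<le> sum v {g \<in> S. f g = j})"
proof -
  let ?worst = "\<lambda>f. Min ((\<lambda>j. sum v {g \<in> S. f g = j}) ` {..<d})"
  have "mms d v S = Max (?worst ` (S \<rightarrow>\<^sub>E {..<d}))"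
    unfolding mms_def by (simp only: setcompr_eq_image Collect_mem_eq)
  moreover have "finite (S \<rightarrow>\<^sub>E {..<d})" "S \<rightarrow>\<^sub>E {..<d} \<noteq> {}"
    using assms by (auto simp: PiE_eq_empty_iff finite_PiE)
  ultimately have "t \<le> mms d v S \<longleftrightarrow> (\<exists>f\<in>S \<rightarrow>\<^sub>E {..<d}. t \<le> ?worst f)"
    by (simp add: Max_ge_iff)
  moreover have "t \<le> ?worst f \<longleftrightarrow> (\<forall>j<d. t \<le> sum v {g \<in> S. f g = j})" for f
    using assms(2) by (subst Min_ge_iff) auto
  ultimately have "t \<le> mms d v S \<longleftrightarrow> (\<exists>f\<in>S \<rightarrow>\<^sub>E {..<d}. \<forall>j<d. t \<le> sum v {g \<in> S. f g = j})"
    by simp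
  also have "\<dots> \<longleftrightarrow> (\<exists>f\<in>S \<rightarrow> {..<d}. \<forall>j<d. t \<le> sum v {g \<in> S. f g = j})"
  proof
    assume "\<exists>f\<in>S \<rightarrow> {..<d}. \<forall>j<d. t \<le> sum v {g \<in> S. f g = j}"
    then obtain f where f: "f \<in> S \<rightarrow> {..<d}" "\<forall>j<d. t \<le> sum v {g \<in> S. f g = j}" by blast
    have "{g \<in> S. restrict f S g = j} = {g \<in> S. f g = j}" for j by auto
    then show "\<exists>f\<in>S \<rightarrow>\<^sub>E {..<d}. \<forall>j<d. t \<le> sum v {g \<in> S. f g = j}"
      using f by (intro bexI[of _ "restrict f S"]) auto
  qed (auto simp: PiE_def)
  finally show ?thesis .
qed

lemma le_mmsE:
  assumes "t \<le> mms d v S" "finite S" "0 < d"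
  obtains B where "disjoint_family_on B {..<d}" "(\<Union>j<d. B j) = S" "\<forall>j<d. t \<le> sum v (B j)"
proof -
  obtain f where "f \<in> S \<rightarrow> {..<d}" "\<forall>j<d. t \<le> sum v {g \<in> S. f g = j}"
    using assms(1) unfolding le_mms_iff[OF assms(2,3)] by blast
  then show thesis
    by (intro that[of "\<lambda>j. {g \<in> S. f g = j}"]) (auto simp: disjoint_family_on_def)
qed

lemma le_mmsI:
  assumes "finite S" "\<And>g. g \<in> S \<Longrightarrow> 0 \<le> v g" "0 < d" "card J = d"
    and disjoint: "disjoint_family_on B J"
    and bundles: "\<And>j. j \<in> J \<Longrightarrow> B j \<subseteq> S" "\<And>j. j \<in> J \<Longrightarrow> t \<le> sum v (B j)"
  shows "t \<le> mms d v S"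
proof -
  have "finite J" using assms(3,4) card.infinite by force
  then obtain \<beta> where \<beta>: "bij_betw \<beta> J {..<d}"
    using assms(4) by (metis ex_bij_betw_finite_nat lessThan_atLeast0)
  have "\<exists>l<d. \<forall>j\<in>J. g \<in> B j \<longrightarrow> \<beta> j = l" for g
  proof (cases "\<exists>j\<in>J. g \<in> B j")
    case True
    then obtain j where "j \<in> J" "g \<in> B j" by blast
    then show ?thesis
      using bij_betwE[OF \<beta>] disjoint_family_onD[OF disjoint] by (intro exI[of _ "\<beta> j"]) blast
  qed (use assms(3) in blast)
  then obtain f where f: "\<And>g. f g < d" "\<And>g j. j \<in> J \<Longrightarrow> g \<in> B j \<Longrightarrow> \<beta> j = f g" by metis
  have "t \<le> sum v {g \<in> S. f g = l}" if "l < d" for l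
  proof -
    have "l \<in> \<beta> ` J" using bij_betw_imp_surj_on[OF \<beta>] that by simp
    then obtain j where j: "j \<in> J" "\<beta> j = l" by blast
    have "B j \<subseteq> {g \<in> S. f g = l}" using bundles(1) f(2) j by auto
    then have "sum v (B j) \<le> sum v {g \<in> S. f g = l}"
      using assms(1,2) by (intro sum_mono2) auto
    with bundles(2)[OF j(1)] show ?thesis by linarith
  qed
  then show ?thesis using f(1) le_mms_iff[OF assms(1,3)] by auto
qed

lemma le_mms_imageI:
  assumes "finite T" "\<And>g. g \<in> T \<Longrightarrow> 0 \<le> u g" "0 < d" "card J = d"
    and B: "disjoint_family_on B J" "\<And>j. j \<in> J \<Longrightarrow> B j \<subseteq> S" "\<And>j. j \<in> J \<Longrightarrow> t \<le> sum v (B j)"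
    and \<psi>: "inj_on \<psi> S" "\<psi> ` S \<subseteq> T" "\<And>g. g \<in> S \<Longrightarrow> v g \<le> u (\<psi> g)"
  shows "t \<le> mms d u T"
proof (rule le_mmsI[where J = J and B = "\<lambda>j. \<psi> ` B j"])
  show "disjoint_family_on (\<lambda>j. \<psi> ` B j) J"
    unfolding disjoint_family_on_def
  proof (intro ballI impI)
    fix i j assume ij: "i \<in> J" "j \<in> J" "i \<noteq> j"
    then have "\<psi> ` B i \<inter> \<psi> ` B j = \<psi> ` (B i \<inter> B j)"
      using inj_on_image_Int[OF \<psi>(1)] B(2) by simp
    then show "\<psi> ` B i \<inter> \<psi> ` B j = {}" using disjoint_family_onD[OF B(1)] ij by simp
  qed
  fix j assume j: "j \<in> J"
  then show "\<psi> ` B j \<subseteq> T" using B(2) \<psi>(2) by blast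
  have "t \<le> sum v (B j)" using B(3) j .
  also have "\<dots> \<le> (\<Sum>g\<in>B j. u (\<psi> g))" using B(2)[OF j] \<psi>(3) by (intro sum_mono) auto
  also have "\<dots> = sum u (\<psi> ` B j)"
    using inj_on_subset[OF \<psi>(1) B(2)[OF j]] by (simp add: sum.reindex)
  finally show "t \<le> sum u (\<psi> ` B j)" .
qed (use assms(1-4) in auto)

lemma mms_nonneg:
  assumes "finite S" "0 < d" "\<And>g. g \<in> S \<Longrightarrow> 0 \<le> v g"
  shows "0 \<le> mms d v S"
  unfolding le_mms_iff[OF assms(1,2)]
  using assms(2,3) by (intro bexI[of _ "\<lambda>_. 0"]) (auto intro: sum_nonneg)

lemma mms_mono:
  assumes "finite S" "0 < d" "\<And>g. g \<in> S \<Longrightarrow> v g \<le> u g"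
  shows "mms d v S \<le> mms d u S"
proof -
  obtain f where "f \<in> S \<rightarrow> {..<d}" "\<forall>j<d. mms d v S \<le> sum v {g \<in> S. f g = j}"
    using le_mms_iff[THEN iffD1, OF assms(1,2) order.refl] by blast
  moreover have "sum v {g \<in> S. f g = j} \<le> sum u {g \<in> S. f g = j}" for j
    using assms(3) by (intro sum_mono) auto
  ultimately show ?thesis
    unfolding le_mms_iff[OF assms(1,2)] by (meson order_trans)
qed

lemma mms_divide:
  assumes "finite S" "0 < d" "0 < c"
  shows "mms d (\<lambda>g. v g / c) S = mms d v S / c"
proof -
  have "t \<le> mms d (\<lambda>g. v g / c) S \<longleftrightarrow> t * c \<le> mms d v S" for t
    using assms by (simp add: le_mms_iff pos_le_divide_eq flip: sum_divide_distrib)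
  then have "t \<le> mms d (\<lambda>g. v g / c) S \<longleftrightarrow> t \<le> mms d v S / c" for t
    using assms(3) by (simp add: pos_le_divide_eq)
  then show ?thesis by (meson order.antisym order.refl)
qed

lemma mms_reindex:
  assumes "finite S" "0 < d" and \<sigma>: "bij_betw \<sigma> T S" and u: "\<And>x. x \<in> T \<Longrightarrow> u x = v (\<sigma> x)"
  shows "mms d u T = mms d v S"
proof -
  have "finite T" using \<sigma> assms(1) bij_betw_finite by blast
  have sum_bundle: "sum u {x \<in> T. f' x = j} = sum v {g \<in> S. f g = j}"
    if "\<And>x. x \<in> T \<Longrightarrow> f' x = f (\<sigma> x)" for f f' and j :: nat
  proof -
    have "bij_betw \<sigma> {x \<in> T. f' x = j} {g \<in> S. f g = j}"
      using \<sigma> that by (auto simp: bij_betw_def intro: inj_on_subset)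
    then have "(\<Sum>x | x \<in> T \<and> f' x = j. v (\<sigma> x)) = sum v {g \<in> S. f g = j}"
      by (rule sum.reindex_bij_betw)
    moreover have "sum u {x \<in> T. f' x = j} = (\<Sum>x | x \<in> T \<and> f' x = j. v (\<sigma> x))"
      using u by (intro sum.cong) auto
    ultimately show ?thesis by simp
  qed
  have "mms d v S \<le> mms d u T"
  proof -
    obtain f where "f \<in> S \<rightarrow> {..<d}" "\<forall>j<d. mms d v S \<le> sum v {g \<in> S. f g = j}"
      using le_mms_iff[THEN iffD1, OF assms(1,2) order.refl] by blast
    then show ?thesis
      unfolding le_mms_iff[OF \<open>finite T\<close> assms(2)]
      using sum_bundle[of "f \<circ> \<sigma>" f] bij_betwE[OF \<sigma>] by (intro bexI[of _ "f \<circ> \<sigma>"]) auto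
  qed
  moreover have "mms d u T \<le> mms d v S"
  proof -
    obtain f where "f \<in> T \<rightarrow> {..<d}" "\<forall>j<d. mms d u T \<le> sum u {x \<in> T. f x = j}"
      using le_mms_iff[THEN iffD1, OF \<open>finite T\<close> assms(2) order.refl] by blast
    then show ?thesis
      unfolding le_mms_iff[OF assms(1,2)]
      using sum_bundle[of f "f \<circ> inv_into T \<sigma>"] bij_betw_inv_into_left[OF \<sigma>]
        bij_betwE[OF bij_betw_inv_into[OF \<sigma>]]
      by (intro bexI[of _ "f \<circ> inv_into T \<sigma>"]) auto
  qed
  ultimately show ?thesis by (rule order.antisym[rotated])
qed

lemma mms_eq_if_map_eq:
  assumes "distinct xs" "distinct ys" "map u xs = map v ys" "0 < d"
  shows "mms d u (set xs) = mms d v (set ys)"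
proof -
  have by_position: "mms d (nth (map u' zs)) {..<length zs} = mms d u' (set zs)"
    if "distinct zs" for u' :: "'c \<Rightarrow> real" and zs
    using that assms(4) by (intro mms_reindex[of _ _ "nth zs"] bij_betw_nth) auto
  show ?thesis
    using by_position[OF assms(1), of u] by_position[OF assms(2), of v]
      assms(3) map_eq_imp_length_eq[OF assms(3)]
    by simp
qed

section \<open>Removing goods\<close>

lemma card_Diff_le_card_Int_bundle:
  assumes "finite J" "J \<noteq> {}" "disjoint_family_on B J" "finite F" "finite R"
    and cover: "F \<union> R \<subseteq> (\<Union>j\<in>J. B j)" and many: "(card J - 1) * (card R - 1) \<le> card F"
  obtains j where "j \<in> J" "card (R - B j) \<le> card (F \<inter> B j)"
proof (rule ccontr)
  assume "\<not> thesis"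
  then have less: "\<forall>j\<in>J. card (F \<inter> B j) < card (R - B j)" using that by force
  have card_eq: "(\<Sum>j\<in>J. card (X \<inter> B j)) = card X" if "finite X" "X \<subseteq> (\<Union>j\<in>J. B j)" for X
  proof -
    have "card (\<Union>j\<in>J. X \<inter> B j) = (\<Sum>j\<in>J. card (X \<inter> B j))"
      using assms(1,3) that(1) by (intro card_UN_disjoint) (auto simp: disjoint_family_on_def)
    moreover have "(\<Union>j\<in>J. X \<inter> B j) = X" using that(2) by blast
    ultimately show ?thesis by simp
  qed
  have "card F + card R + card J = (\<Sum>j\<in>J. card (F \<inter> B j) + card (R \<inter> B j) + 1)"
    using card_eq[of F] card_eq[of R] assms(4,5) cover by (simp add: sum.distrib sum_Suc)
  also have "\<dots> \<le> (\<Sum>j\<in>J. card R)"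
  proof (rule sum_mono)
    fix j assume "j \<in> J"
    then show "card (F \<inter> B j) + card (R \<inter> B j) + 1 \<le> card R"
      using less card_Int_Diff[OF assms(5), of "B j"] by fastforce
  qed
  finally have "card F + card R + card J \<le> card J * card R" by simp
  moreover obtain d where "card J = Suc d" using assms(1,2) by (metis card_0_eq not0_implies_Suc)
  ultimately show False using many by (cases "card R") auto
qed

text \<open>By pigeonhole some bundle contains at least as many goods of \<^term>\<open>F\<close> as goods of \<^term>\<open>R\<close> lie
  outside it. This bundle is given up and its goods in \<^term>\<open>F\<close> replace the goods that the other
  bundles lose.\<close>
lemma mms_Suc_le_mms_Diff_dominated:
  assumes "finite S" "0 < d" and nonneg: "\<And>g. g \<in> S \<Longrightarrow> 0 \<le> u g"
    and sub: "F \<subseteq> S" "R \<subseteq> S" "F \<inter> R = {}"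
    and dominated: "\<And>x r. x \<in> F \<Longrightarrow> r \<in> R \<Longrightarrow> u r \<le> u x"
    and many: "d * (card R - 1) \<le> card F"
  shows "mms (Suc d) u S \<le> mms d u (S - R)"
proof -
  obtain B where B: "disjoint_family_on B {..<Suc d}" "(\<Union>j<Suc d. B j) = S"
    "\<forall>j<Suc d. mms (Suc d) u S \<le> sum u (B j)"
    by (rule le_mmsE[of "mms (Suc d) u S" "Suc d" u S]) (use assms(1) in auto)
  have fin: "finite F" "finite R" using sub assms(1) by (auto intro: finite_subset)
  obtain j\<^sub>0 where j\<^sub>0: "j\<^sub>0 < Suc d" "card (R - B j\<^sub>0) \<le> card (F \<inter> B j\<^sub>0)"
    using card_Diff_le_card_Int_bundle[OF _ _ B(1) fin] B(2) sub many by auto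
  then obtain \<phi> where \<phi>: "inj_on \<phi> (R - B j\<^sub>0)" "\<phi> ` (R - B j\<^sub>0) \<subseteq> F \<inter> B j\<^sub>0"
    using card_le_inj[of "R - B j\<^sub>0" "F \<inter> B j\<^sub>0"] fin by auto
  define \<psi> where "\<psi> g = (if g \<in> R then \<phi> g else g)" for g
  have \<psi>: "inj_on \<psi> (S - B j\<^sub>0)" "\<psi> ` (S - B j\<^sub>0) \<subseteq> S - R"
    using \<phi> sub by (auto simp: \<psi>_def inj_on_def)
  have le_\<psi>: "u g \<le> u (\<psi> g)" if "g \<in> S - B j\<^sub>0" for g
    using that \<phi>(2) dominated by (auto simp: \<psi>_def)
  have remaining: "B j \<subseteq> S - B j\<^sub>0" if "j \<in> {..<Suc d} - {j\<^sub>0}" for j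
    using that B(2) disjoint_family_onD[OF B(1), of j j\<^sub>0] j\<^sub>0(1) by auto
  show ?thesis
  proof (rule le_mms_imageI[where J = "{..<Suc d} - {j\<^sub>0}"])
    show "disjoint_family_on B ({..<Suc d} - {j\<^sub>0})"
      using B(1) by (rule disjoint_family_on_mono[rotated]) auto
  qed (use assms(1,2) nonneg j\<^sub>0(1) B(3) remaining \<psi> le_\<psi> in auto)
qed

text \<open>The bundles of the two removed goods are merged into one.\<close>
lemma mms_Diff_pair_ge:
  assumes "finite S" "0 < d" and nonneg: "\<And>g. g \<in> S \<Longrightarrow> 0 \<le> u g"
    and share: "t \<le> mms (Suc d) u S" and xy: "x \<in> S" "y \<in> S" "u x + u y \<le> t"
  shows "t \<le> mms d u (S - {x, y})"
proof -
  obtain B where B: "disjoint_family_on B {..<Suc d}" "(\<Union>j<Suc d. B j) = S"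
    "\<forall>j<Suc d. t \<le> sum u (B j)"
    by (rule le_mmsE[OF share assms(1) zero_less_Suc])
  obtain a where a: "a < Suc d" "x \<in> B a" using xy(1) unfolding B(2)[symmetric] by blast
  obtain b where b: "b < Suc d" "y \<in> B b" using xy(2) unfolding B(2)[symmetric] by blast
  have fin: "finite (B j)" if "j < Suc d" for j using finite_subset[of "B j" S] B(2) that assms(1) by auto
  define B' where "B' j = (if j = a then B a \<union> B b - {x, y} else B j)" for j
  note disjoint = disjoint_family_onD[OF B(1)]
  show ?thesis
  proof (rule le_mmsI[where J = "{..<Suc d} - {b}" and B = B'])
    show "disjoint_family_on B' ({..<Suc d} - {b})"
      using disjoint a b by (fastforce simp: disjoint_family_on_def B'_def)
    fix j assume j: "j \<in> {..<Suc d} - {b}"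
    show "B' j \<subseteq> S - {x, y}" using B(2) j a b disjoint[of j a] disjoint[of j b] by (auto simp: B'_def)
    show "t \<le> sum u (B' j)"
    proof (cases "j = a")
      case True
      then have ab: "B a \<inter> B b = {}" using disjoint j a b by auto
      then have "x \<noteq> y" using a b by auto
      have "sum u (B' j) = sum u (B a \<union> B b) - sum u {x, y}"
        using True a b fin by (simp add: B'_def sum_diff)
      also have "\<dots> = sum u (B a) + sum u (B b) - (u x + u y)"
        using ab a b fin \<open>x \<noteq> y\<close> by (simp add: sum.union_disjoint)
      finally have "sum u (B' j) = sum u (B a) + sum u (B b) - (u x + u y)" .
      moreover have "t \<le> sum u (B a)" "t \<le> sum u (B b)" using B(3) a(1) b(1) by auto
      ultimately show ?thesis using xy(3) by linarith
    qed (use B(3) j in \<open>simp add: B'_def\<close>)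
  qed (use assms(1,2) nonneg b(1) in auto)
qed

section \<open>Capped valuations\<close>

definition staircase_level :: "real \<Rightarrow> real \<Rightarrow> int" where
  "staircase_level s x = \<lfloor>x / s\<rfloor> + 1"

definition staircase_cap :: "real \<Rightarrow> real \<Rightarrow> real \<Rightarrow> real" where
  "staircase_cap s \<tau> x = min x (\<tau> * of_int (staircase_level s x))"

lemma staircase_level_mono:
  assumes "0 < s" "x \<le> y"
  shows "staircase_level s x \<le> staircase_level s y"
  using assms by (simp add: staircase_level_def floor_mono divide_right_mono)

lemma le_mult_staircase_level:
  assumes "0 < s"
  shows "x \<le> s * of_int (staircase_level s x)"
proof -
  have "x / s \<le> of_int (staircase_level s x)" unfolding staircase_level_def by linarith
  then show ?thesis using assms by (simp add: pos_divide_le_eq mult.commute)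
qed

lemma staircase_cap_le: "staircase_cap s \<tau> x \<le> x"
  by (simp add: staircase_cap_def)

lemma staircase_cap_nonneg:
  assumes "0 < s" "0 \<le> \<tau>" "0 \<le> x"
  shows "0 \<le> staircase_cap s \<tau> x"
  using assms by (simp add: staircase_cap_def staircase_level_def)

lemma mono_staircase_cap:
  assumes "0 < s" "0 \<le> \<tau>"
  shows "mono (staircase_cap s \<tau>)"
proof (rule monoI)
  fix x y :: real assume "x \<le> y"
  then have "\<tau> * of_int (staircase_level s x) \<le> \<tau> * of_int (staircase_level s y)"
    using assms staircase_level_mono by (intro mult_left_mono) auto
  then show "staircase_cap s \<tau> x \<le> staircase_cap s \<tau> y"
    using \<open>x \<le> y\<close> by (auto simp: staircase_cap_def min_def)
qed

lemma staircase_cap_le_mult: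
  assumes "0 < s" "0 \<le> \<tau>" "x < of_int k * s"
  shows "staircase_cap s \<tau> x \<le> of_int k * \<tau>"
proof -
  have "\<lfloor>x / s\<rfloor> < k" using assms(1,3) by (simp add: floor_less_iff pos_divide_less_eq)
  then have "staircase_level s x \<le> k" by (simp add: staircase_level_def)
  then have "of_int (staircase_level s x) * \<tau> \<le> of_int k * \<tau>"
    using assms(2) by (intro mult_right_mono) auto
  then show ?thesis by (simp add: staircase_cap_def mult.commute min.coboundedI2)
qed

lemma sum_staircase_cap_ge:
  fixes m :: int
  assumes "0 < s" "0 \<le> \<tau>" "\<tau> \<le> s" "finite B" and nonneg: "\<And>g. g \<in> B \<Longrightarrow> 0 \<le> w g"
    and worth: "of_int m * s + \<tau> \<le> sum w B"
  shows "of_int (m + 1) * \<tau> \<le> (\<Sum>g\<in>B. staircase_cap s \<tau> (w g))"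
proof -
  let ?level = "\<lambda>g. staircase_level s (w g)" and ?cap = "\<lambda>g. staircase_cap s \<tau> (w g)"
  define C where "C = {g \<in> B. \<tau> * of_int (?level g) < w g}"
  have "C \<subseteq> B" by (auto simp: C_def)
  show ?thesis
  proof (cases "m + 1 \<le> (\<Sum>g\<in>C. ?level g)")
    case True
    then have "of_int (m + 1) * \<tau> \<le> of_int (\<Sum>g\<in>C. ?level g) * \<tau>"
      using assms(2) by (intro mult_right_mono) (simp_all only: of_int_le_iff)
    also have "\<dots> = sum ?cap C"
      unfolding of_int_sum sum_distrib_right by (intro sum.cong) (auto simp: staircase_cap_def C_def)
    also have "\<dots> \<le> sum ?cap B"
      using assms(1,2,4) nonneg \<open>C \<subseteq> B\<close> staircase_cap_nonneg by (intro sum_mono2) auto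
    finally show ?thesis .
  next
    case False
    have "sum w B - sum ?cap B = (\<Sum>g\<in>B. w g - ?cap g)" by (simp add: sum_subtractf)
    also have "\<dots> = (\<Sum>g\<in>C. w g - ?cap g)"
      using assms(4) \<open>C \<subseteq> B\<close> by (intro sum.mono_neutral_right) (auto simp: staircase_cap_def C_def)
    also have "\<dots> \<le> (\<Sum>g\<in>C. (s - \<tau>) * of_int (?level g))"
    proof (rule sum_mono)
      fix g assume "g \<in> C"
      show "w g - ?cap g \<le> (s - \<tau>) * of_int (?level g)"
        using \<open>g \<in> C\<close> le_mult_staircase_level[OF assms(1), of "w g"]
        by (simp add: staircase_cap_def C_def left_diff_distrib)
    qed
    also have "\<dots> = (s - \<tau>) * of_int (\<Sum>g\<in>C. ?level g)" by (simp add: sum_distrib_left)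
    also have "\<dots> \<le> (s - \<tau>) * of_int m"
      using False assms(3) by (intro mult_left_mono) (simp_all only: of_int_le_iff)
    finally show ?thesis using worth by (simp add: algebra_simps)
  qed
qed

lemma mms_staircase_cap_ge:
  fixes m :: int
  assumes "0 < s" "0 \<le> \<tau>" "\<tau> \<le> s" "finite S" "0 < d" and "\<And>g. g \<in> S \<Longrightarrow> 0 \<le> w g"
    and "of_int m * s + \<tau> \<le> mms d w S"
  shows "of_int (m + 1) * \<tau> \<le> mms d (\<lambda>g. staircase_cap s \<tau> (w g)) S"
proof -
  obtain f where "f \<in> S \<rightarrow> {..<d}" "\<forall>j<d. of_int m * s + \<tau> \<le> sum w {g \<in> S. f g = j}"
    using assms(7) le_mms_iff[OF assms(4,5)] by blast
  moreover have "of_int (m + 1) * \<tau> \<le> (\<Sum>g | g \<in> S \<and> f g = j. staircase_cap s \<tau> (w g))"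
    if "of_int m * s + \<tau> \<le> sum w {g \<in> S. f g = j}" for j
    using that assms(4,6) by (intro sum_staircase_cap_ge assms(1-3)) auto
  ultimately show ?thesis unfolding le_mms_iff[OF assms(4,5)] by blast
qed

section \<open>Ordered goods and the reduction rules\<close>

definition ordered_goods :: "('a \<Rightarrow> real) \<Rightarrow> 'a list \<Rightarrow> bool" where
  "ordered_goods u G \<longleftrightarrow>
     distinct G \<and> sorted_wrt (\<lambda>g g'. u g' \<le> u g) G \<and> (\<forall>g\<in>set G. 0 \<le> u g)"

lemma ordered_goods_nth_mono:
  assumes "ordered_goods u G" "p \<le> q" "q < length G"
  shows "u (G ! q) \<le> u (G ! p)"
  using assms sorted_wrt_nth_less[of "\<lambda>g g'. u g' \<le> u g" G p q]
  by (cases "p = q") (auto simp: ordered_goods_def)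

lemma sorted_wrt_nths: "sorted_wrt P xs \<Longrightarrow> sorted_wrt P (nths xs I)"
  by (induction xs arbitrary: I) (auto simp: nths_Cons dest: in_set_nthsD)

lemma ordered_goods_nths: "ordered_goods u G \<Longrightarrow> ordered_goods u (nths G I)"
  by (auto simp: ordered_goods_def sorted_wrt_nths dest: in_set_nthsD)

lemma ordered_goods_mono_comp:
  assumes "ordered_goods u G" "mono f" "0 \<le> f 0"
  shows "ordered_goods (\<lambda>g. f (u g)) G"
proof -
  have "sorted_wrt (\<lambda>g g'. f (u g') \<le> f (u g)) G"
    using assms(1,2) by (auto simp: ordered_goods_def intro: sorted_wrt_mono_rel[rotated] monoD)
  moreover have "0 \<le> f (u g)" if "g \<in> set G" for g
    using that assms order.trans[OF assms(3) monoD[OF assms(2), of 0 "u g"]]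
    by (simp add: ordered_goods_def)
  ultimately show ?thesis using assms(1) by (simp add: ordered_goods_def)
qed

lemma mms_Suc_le_mms_Diff_block:
  assumes G: "ordered_goods u G" and "0 < d"
  shows "mms (Suc d) u (set G) \<le> mms d u (set G - set (take (Suc c) (drop (c * d) G)))"
proof (rule mms_Suc_le_mms_Diff_dominated)
  let ?F = "take (c * d) G" and ?R = "take (Suc c) (drop (c * d) G)"
  have split: "distinct (?F @ drop (c * d) G)" "sorted_wrt (\<lambda>g g'. u g' \<le> u g) (?F @ drop (c * d) G)"
    using G by (simp_all add: ordered_goods_def)
  show sub: "set ?F \<subseteq> set G" "set ?R \<subseteq> set G"
    by (auto dest: in_set_takeD in_set_dropD)
  show "set ?F \<inter> set ?R = {}"
    using split(1) by (auto dest: in_set_takeD simp del: append_take_drop_id)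
  show "u r \<le> u x" if "x \<in> set ?F" "r \<in> set ?R" for x r
    using split(2) that by (auto simp: sorted_wrt_append dest: in_set_takeD simp del: append_take_drop_id)
  have "card (set ?F) = length ?F" "card (set ?R) = length ?R"
    using G by (simp_all add: ordered_goods_def distinct_card)
  moreover have "length ?R - 1 \<le> c" "length ?R = 0 \<or> length ?F = c * d" by auto
  ultimately show "d * (card (set ?R) - 1) \<le> card (set ?F)"
    by (metis diff_0_eq_0 le0 mult.commute mult_0_right mult_le_mono1)
qed (use assms in \<open>auto simp: ordered_goods_def\<close>)

lemma rule_goods_eq_set_nths: "rule_goods k A G = set (nths G {j. Suc j \<in> rule_pos k (card A)})"
proof -
  have "P \<inter> {1..length G} = Suc ` {j. j < length G \<and> Suc j \<in> P}" for P
    by (auto simp: image_Collect Suc_le_eq gr0_conv_Suc)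
  then show ?thesis by (auto simp: rule_goods_def set_nths image_image)
qed

lemma remove_pos_eq_nths: "remove_pos k A G = nths G {j. Suc j \<notin> rule_pos k (card A)}"
proof -
  have "nths G I = map (nth G) (filter (\<lambda>j. j \<in> I) [0..<length G])" for I
  proof -
    have "zip G [0..<length G] = map (\<lambda>j. (G ! j, j)) [0..<length G]" by (rule nth_equalityI) simp_all
    then show ?thesis by (simp add: nths_def filter_map comp_def)
  qed
  moreover have "[1..<Suc (length G)] = map Suc [0..<length G]" by (simp add: map_Suc_upt)
  ultimately show ?thesis by (simp add: remove_pos_def filter_map comp_def)
qed

lemma set_remove_pos:
  assumes "distinct G"
  shows "set (remove_pos k A G) = set G - rule_goods k A G"
  unfolding remove_pos_eq_nths rule_goods_eq_set_nths
  using assms by (fastforce simp: set_nths nth_eq_iff_index_eq in_set_conv_nth)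

lemma rule_goods_eq_block:
  assumes "(k, c) \<in> {(1, 0), (2, 2), (3, 3)}" "card A = Suc d"
  shows "rule_goods k A G = set (take (Suc c) (drop (c * d) G))"
proof -
  have "{j. Suc j \<in> rule_pos k (card A)} = {c * d..<Suc c + c * d}"
    using assms by (auto simp: rule_pos_def)
  also have "\<dots> = (+) (c * d) ` {..<Suc c}"
    by (simp only: image_add_atLeastLessThan lessThan_atLeast0 add_0)
  finally show ?thesis
    unfolding rule_goods_eq_set_nths by (simp flip: nths_drop del: lessThan_Suc)
qed

lemma rule_goods_4_eq_pair:
  assumes "2 * card A < length G"
  shows "rule_goods 4 A G = {G ! 0, G ! (2 * card A)}"
  using assms by (auto simp: rule_goods_eq_set_nths rule_pos_def set_nths)

lemma rule_goods_4_eq_rule_goods_1: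
  assumes "length G \<le> 2 * card A"
  shows "rule_goods 4 A G = rule_goods 1 A G"
  using assms by (auto simp: rule_goods_def rule_pos_def)

lemma rule_goods_cases:
  assumes "k \<in> {1..4}" "card A = Suc d"
  obtains (block) c where "rule_goods k A G = set (take (Suc c) (drop (c * d) G))"
    | (pair) "k = 4" "2 * card A < length G"
proof -
  consider "k = 1" | "k = 2" | "k = 3" | "k = 4" "length G \<le> 2 * card A" | "k = 4" "2 * card A < length G"
    using assms(1) by fastforce
  then show thesis
  proof cases
    case 1
    then show ?thesis using rule_goods_eq_block[of 1 0, OF _ assms(2)] by (intro block[of 0]) simp
  next
    case 2
    then show ?thesis using rule_goods_eq_block[of 2 2, OF _ assms(2)] by (intro block[of 2]) simp
  next
    case 3
    then show ?thesis using rule_goods_eq_block[of 3 3, OF _ assms(2)] by (intro block[of 3]) simp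
  next
    case 4
    then show ?thesis
      using rule_goods_4_eq_rule_goods_1 rule_goods_eq_block[of 1 0, OF _ assms(2)]
      by (intro block[of 0]) simp
  qed (rule pair)
qed

lemma value_rule_goods_4_less:
  assumes G: "ordered_goods (w i) G" and "i \<in> A" "0 < card A" "2 * card A < length G"
    and "\<not> applicable w \<alpha> 1 A G" "\<not> applicable w \<alpha> 2 A G"
  shows "w i (G ! 0) < \<alpha>" "3 * w i (G ! (2 * card A)) < \<alpha>"
proof -
  obtain d where d: "card A = Suc d" using assms(3) gr0_conv_Suc by blast
  have "rule_goods 1 A G = {G ! 0}"
    using assms(4) by (auto simp: rule_goods_def rule_pos_def)
  then show "w i (G ! 0) < \<alpha>" using assms(2,5) by (auto simp: applicable_def not_le)
  let ?R = "take 3 (drop (2 * d) G)" and ?y = "w i (G ! (2 * card A))"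
  have "card (set ?R) = length ?R" using G by (intro distinct_card) (simp add: ordered_goods_def)
  then have "card (set ?R) = 3" using assms(4) d by simp
  moreover have "?y \<le> w i r" if r: "r \<in> set ?R" for r
  proof -
    obtain p where "p < 3" "r = G ! (2 * d + p)" using r by (auto simp: in_set_conv_nth)
    then show ?thesis using ordered_goods_nth_mono[OF G, of "2 * d + p" "2 * card A"] assms(4) d by simp
  qed
  ultimately have "3 * ?y \<le> sum (w i) (set ?R)"
    using sum_bounded_below[of "set ?R" ?y "w i"] by simp
  moreover have "rule_goods 2 A G = set ?R"
    using rule_goods_eq_block[of 2 2 A d G] d by simp
  moreover have "sum (w i) (rule_goods 2 A G) < \<alpha>"
    using assms(2,6) by (auto simp: applicable_def not_le)
  ultimately show "3 * ?y < \<alpha>" by simp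
qed

section \<open>The reduction loop\<close>

lemma mms_remove_pos_ge:
  assumes k: "k \<in> {1..4}" "\<forall>k'\<in>{1..<k}. \<not> applicable w (3 * s) k' A G"
    and A: "i \<in> A" "card A = Suc d" "0 < d" and G: "ordered_goods (w i) G" and bounds: "0 < s" "0 \<le> \<tau>"
    and share: "4 * \<tau> \<le> mms (card A) (\<lambda>g. staircase_cap s \<tau> (w i g)) (set G)"
  shows "4 * \<tau> \<le> mms d (\<lambda>g. staircase_cap s \<tau> (w i g)) (set (remove_pos k A G))"
proof -
  let ?u = "\<lambda>g. staircase_cap s \<tau> (w i g)"
  note share = share[unfolded A(2)]
  have u: "ordered_goods ?u G"
    using G mono_staircase_cap[OF bounds] staircase_cap_nonneg[OF bounds]
    by (intro ordered_goods_mono_comp[where f = "staircase_cap s \<tau>"]) auto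
  have remove: "set (remove_pos k A G) = set G - rule_goods k A G"
    using G by (intro set_remove_pos) (simp add: ordered_goods_def)
  show ?thesis
    using k(1) A(2)
  proof (cases rule: rule_goods_cases[where G = G])
    case (block c)
    then show ?thesis using order.trans[OF share mms_Suc_le_mms_Diff_block[OF u A(3), of c]] remove by simp
  next
    case pair
    let ?x = "G ! 0" and ?y = "G ! (2 * card A)"
    have "w i ?x < 3 * s" "3 * w i ?y < 3 * s"
      using value_rule_goods_4_less[of w i G A "3 * s"] G A k(2) pair by auto
    then have "?u ?x \<le> 3 * \<tau>" "?u ?y \<le> 1 * \<tau>"
      using staircase_cap_le_mult[OF bounds, of _ 3] staircase_cap_le_mult[OF bounds, of _ 1]
      by auto
    moreover have "?x \<in> set G" "?y \<in> set G" using pair(2) by (intro nth_mem; linarith)+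
    ultimately have "4 * \<tau> \<le> mms d ?u (set G - {?x, ?y})"
      using u share A(3) by (intro mms_Diff_pair_ge) (auto simp: ordered_goods_def)
    then show ?thesis using remove rule_goods_4_eq_pair[OF pair(2)] pair(1) by simp
  qed
qed

lemma reduce_loop_agents_subset: "reduce_loop w \<alpha> A G A' G' \<Longrightarrow> A' \<subseteq> A"
  by (induction rule: reduce_loop.induct) auto

lemma reduce_loop_ordered_goods:
  "reduce_loop w \<alpha> A G A' G' \<Longrightarrow> ordered_goods u G \<Longrightarrow> ordered_goods u G'"
  by (induction rule: reduce_loop.induct) (auto simp: remove_pos_eq_nths ordered_goods_nths)

lemma reduce_loop_mms_staircase_cap_ge:
  assumes "reduce_loop w (3 * s) A G A' G'" "i \<in> A'" "finite A" "ordered_goods (w i) G" "0 < s" "0 \<le> \<tau>"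
    and "4 * \<tau> \<le> mms (card A) (\<lambda>g. staircase_cap s \<tau> (w i g)) (set G)"
  shows "4 * \<tau> \<le> mms (card A') (\<lambda>g. staircase_cap s \<tau> (w i g)) (set G')"
  using assms
proof (induction rule: reduce_loop.induct)
  case (stop A G)
  then show ?case by simp
next
  case (step k A G a A' G')
  have i: "i \<in> A" "i \<in> A - {a}"
    using reduce_loop_agents_subset[OF step.hyps(6)] step.prems(1) by auto
  have A: "card A = Suc (card (A - {a}))" "0 < card (A - {a})"
    using card.remove[OF step.prems(2) step.hyps(4)] i step.prems(2) by (auto simp: card_gt_0_iff)
  have "4 * \<tau> \<le> mms (card (A - {a})) (\<lambda>g. staircase_cap s \<tau> (w i g)) (set (remove_pos k A G))"
    by (rule mms_remove_pos_ge[OF step.hyps(1,3) i(1) A step.prems(3-6)])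
  moreover have "ordered_goods (w i) (remove_pos k A G)"
    using step.prems(3) by (simp add: remove_pos_eq_nths ordered_goods_nths)
  ultimately show ?case using step.IH step.prems(1,2,4,5) by simp
qed

lemma reduce_loop_mms_ge:
  assumes loop: "reduce_loop w \<alpha> A G A' G'" and "i \<in> A'" "finite A"
    and G: "ordered_goods (w i) G" and "3/4 \<le> \<alpha>" and share: "1 \<le> mms (card A) (w i) (set G)"
  shows "4 * (1 - \<alpha>) \<le> mms (card A') (w i) (set G')"
proof -
  have "A' \<subseteq> A" using reduce_loop_agents_subset[OF loop] .
  then have card: "0 < card A" "0 < card A'"
    using assms(2,3) finite_subset[of A' A] by (auto simp: card_gt_0_iff)
  have G': "ordered_goods (w i) G'" using reduce_loop_ordered_goods[OF loop G] .
  show ?thesis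
  proof (cases "\<alpha> \<le> 1")
    case True
    define s \<tau> where "s = \<alpha> / 3" and "\<tau> = 1 - \<alpha>"
    have s\<tau>: "0 < s" "0 \<le> \<tau>" "\<tau> \<le> s" "of_int 3 * s + \<tau> = 1"
      using True assms(5) by (auto simp: s_def \<tau>_def)
    have "4 * \<tau> \<le> mms (card A) (\<lambda>g. staircase_cap s \<tau> (w i g)) (set G)"
      using mms_staircase_cap_ge[OF s\<tau>(1-3), of "set G" "card A" "w i" 3] s\<tau>(4) card(1) G share
      by (simp add: ordered_goods_def)
    moreover have "reduce_loop w (3 * s) A G A' G'" using loop by (simp add: s_def)
    ultimately have "4 * \<tau> \<le> mms (card A') (\<lambda>g. staircase_cap s \<tau> (w i g)) (set G')"
      using reduce_loop_mms_staircase_cap_ge assms(2,3) G s\<tau>(1,2) by blast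
    also have "\<dots> \<le> mms (card A') (w i) (set G')"
      using card by (intro mms_mono) (auto simp: staircase_cap_le)
    finally show ?thesis by (simp add: \<tau>_def)
  next
    case False
    moreover have "0 \<le> mms (card A') (w i) (set G')"
      using G' card by (intro mms_nonneg) (auto simp: ordered_goods_def)
    ultimately show ?thesis by simp
  qed
qed

section \<open>Ordered and normalised valuations\<close>

lemma ordv_enumeration:
  assumes "finite M"
  obtains xs where "set xs = M" "distinct xs" "sorted_wrt (\<lambda>g g'. v i g' \<le> v i g) xs"
    "map (ordv M v i) [1..<Suc (card M)] = map (v i) xs"
proof -
  obtain ys where ys: "set ys = M" "distinct ys" using assms finite_distinct_list by blast
  define xs where "xs = rev (sort_key (v i) ys)"
  have xs: "set xs = M" "distinct xs" "length xs = card M"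
    using ys by (auto simp: xs_def distinct_card)
  have sorted: "sorted (map (v i) (rev xs))" by (simp add: xs_def)
  have "image_mset (v i) (mset_set M) = mset (map (v i) (rev xs))"
    using xs mset_set_set[of xs] by simp
  then have "rev (sorted_list_of_multiset (image_mset (v i) (mset_set M))) = map (v i) xs"
    using sorted by (simp only: sorted_list_of_multiset_mset sorted_sort_id) (simp flip: rev_map)
  then have "map (ordv M v i) [1..<Suc (card M)] = map (v i) xs"
    using xs(3) by (intro nth_equalityI) (auto simp: ordv_def simp del: upt_Suc)
  moreover have "sorted_wrt (\<lambda>g g'. v i g' \<le> v i g) xs"
    using sorted by (simp add: sorted_wrt_map sorted_wrt_rev flip: rev_map)
  ultimately show thesis using that xs by blast
qed

lemma mms_ordv:
  assumes "finite M" "0 < d"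
  shows "mms d (ordv M v i) {1..card M} = mms d (v i) M"
proof -
  obtain xs where "set xs = M" "distinct xs" "map (ordv M v i) [1..<Suc (card M)] = map (v i) xs"
    using ordv_enumeration[OF assms(1)] by metis
  then have "mms d (ordv M v i) (set [1..<Suc (card M)]) = mms d (v i) M"
    using assms(2) mms_eq_if_map_eq[of "[1..<Suc (card M)]" xs] by (metis distinct_upt)
  moreover have "set [1..<Suc (card M)] = {1..card M}" by auto
  ultimately show ?thesis by simp
qed

lemma ordered_goods_ordv:
  assumes "finite M" "\<And>g. g \<in> M \<Longrightarrow> 0 \<le> v i g"
  shows "ordered_goods (ordv M v i) [1..<Suc (card M)]"
proof -
  let ?G = "[1..<Suc (card M)]"
  obtain xs where xs: "set xs = M" "sorted_wrt (\<lambda>g g'. v i g' \<le> v i g) xs"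
    "map (ordv M v i) ?G = map (v i) xs"
    using ordv_enumeration[OF assms(1)] by metis
  have "sorted_wrt (\<lambda>x y. y \<le> x) (map (ordv M v i) ?G)"
    unfolding xs(3) using xs(2) by (simp add: sorted_wrt_map)
  moreover have "0 \<le> ordv M v i j" if "j \<in> set ?G" for j
  proof -
    have "ordv M v i ` set ?G = v i ` M"
      using arg_cong[OF xs(3), of set] xs(1) by (simp only: set_map)
    then have "ordv M v i j \<in> v i ` M" using that by blast
    then show ?thesis using assms(2) by auto
  qed
  ultimately show ?thesis by (simp add: ordered_goods_def sorted_wrt_map del: upt_Suc)
qed

lemma normv_eq:
  assumes "finite M" "0 < card N"
  shows "normv N M v i = (\<lambda>j. ordv M v i j / mms (card N) (v i) M)"
  unfolding normv_def mms_ordv[OF assms] ..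

lemma mms_normv:
  assumes "finite M" "0 < card N" "0 < mms (card N) (v i) M"
  shows "mms (card N) (normv N M v i) {1..card M} = 1"
  unfolding normv_eq[OF assms(1,2)]
  using assms by (simp add: mms_divide mms_ordv del: One_nat_def)

lemma ordered_goods_normv:
  assumes "finite M" "0 < card N" "0 < mms (card N) (v i) M" "\<And>g. g \<in> M \<Longrightarrow> 0 \<le> v i g"
  shows "ordered_goods (normv N M v i) [1..<Suc (card M)]"
  unfolding normv_eq[OF assms(1,2)]
proof (rule ordered_goods_mono_comp[where f = "\<lambda>x. x / mms (card N) (v i) M"])
  show "ordered_goods (ordv M v i) [1..<Suc (card M)]"
    using assms(1,4) by (rule ordered_goods_ordv)
  show "mono (\<lambda>x. x / mms (card N) (v i) M)"
    using assms(3) by (simp add: mono_def divide_right_mono)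
qed simp

theorem theorem13:
  fixes N :: "nat set" and M :: "'g set" and v :: "nat \<Rightarrow> 'g \<Rightarrow> real" and \<epsilon> :: real
    and N' :: "nat set" and M' :: "nat set" and i :: nat
  assumes "finite N" and "finite M"
    and "\<forall>a\<in>N. \<forall>g\<in>M. v a g \<ge> 0"
    and "\<forall>a\<in>N. mms (card N) (v a) M > 0"
    and "\<epsilon> \<ge> 0"
    and "reduce N M v \<epsilon> N' M'"
    and "i \<in> N'"
  shows "mms (card N') (normv N M v i) M' \<ge> 1 - 4 * \<epsilon>"
proof -
  obtain G' where loop: "reduce_loop (normv N M v) (3/4 + \<epsilon>) N [1..<Suc (card M)] N' G'"
    and M': "M' = set G'"
    using assms(6) by (auto simp: reduce_def)
  have "i \<in> N" using reduce_loop_agents_subset[OF loop] assms(7) by blast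
  then have i: "0 < card N" "\<And>g. g \<in> M \<Longrightarrow> 0 \<le> v i g" "0 < mms (card N) (v i) M"
    using assms(1,3,4) by (auto simp: card_gt_0_iff)
  have "set [1..<Suc (card M)] = {1..card M}" by auto
  then have "mms (card N) (normv N M v i) (set [1..<Suc (card M)]) = 1"
    using mms_normv[of M N v i] assms(2) i by simp
  then have "4 * (1 - (3/4 + \<epsilon>)) \<le> mms (card N') (normv N M v i) (set G')"
    using assms(1,2,5,7) i
    by (intro reduce_loop_mms_ge[OF loop] ordered_goods_normv) (simp_all del: upt_Suc)
  then show ?thesis by (simp add: M')
qed

end
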